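(* Let $\mathcal{A},\Gamma$ be torsion free Abelian groups and $a_1,\dots,a_n\in\mathcal{A}$. A function $f:\mathcal{A}\to\Gamma$ decomposes into a sum $f=f_1+\cdots+f_n$ of functions $f_j:\mathcal{A}\to\Gamma$ with $f_j$ being $a_j$-periodic for each $j=1,\dots,n$, if and only if for all partitions $B_1\cup B_2\cup\cdots\cup B_N=\{a_1,\dots,a_n\}$, with $b_j$ denoting the least common multiple of the elements in $B_j$ ($j=1,\dots,N$), one has $$\Delta_{b_1}\cdots\Delta_{b_N}f=0.$$
   Context: The groups are written additively. For $a\in\mathcal{A}$ and a function $f:\mathcal{A}\to\Gamma$, $\Delta_a f(x):=f(x+a)-f(x)$; $f$ is $a$-periodic if $\Delta_a f=0$. In a torsion free Abelian group, the least common multiple of elements $c_1,\dots,c_m$ is the generator, unique up to taking the inverse, of the cyclic group $\langle c_1\rangle\cap\cdots\cap\langle c_m\rangle$, where $\langle c\rangle$ denotes the cyclic subgroup generated by $c$; it may be $0$ (e.g. the least common multiple of $1$ and $\sqrt2$ in $(\mathbb{R},+)$ is $0$). Either choice of the generator may be used. Partitions are partitions of the set $\{a_1,\dots,a_n\}$ into nonempty blocks. *)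

theory Defs
  imports
    Main
    "HOL-Library.Disjoint_Sets"
    "HOL-Computational_Algebra.Group_Closure"
begin

text \<open>The iterate \<^term>\<open>((+) x ^^ n) 0\<close> is the \<open>n\<close>-fold sum of \<open>x\<close>.\<close>

definition torsion_free :: "'a::ab_group_add itself \<Rightarrow> bool" where
  "torsion_free _ \<longleftrightarrow> (\<forall>(x::'a) n. 0 < n \<longrightarrow> ((+) x ^^ n) 0 = 0 \<longrightarrow> x = 0)"

definition diff_op :: "'a::ab_group_add \<Rightarrow> ('a \<Rightarrow> 'b::ab_group_add) \<Rightarrow> 'a \<Rightarrow> 'b" where
  "diff_op a f = (\<lambda>x. f (x + a) - f x)"

definition periodic :: "'a::ab_group_add \<Rightarrow> ('a \<Rightarrow> 'b::ab_group_add) \<Rightarrow> bool" where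
  "periodic a f \<longleftrightarrow> diff_op a f = (\<lambda>x. 0)"

text \<open>
  A relation rather than a function, because the least common multiple is determined only up to
  sign (in a torsion free group). For nonempty \<open>B\<close> such a \<open>b\<close> always exists, see \<open>ex_is_lcm\<close>;
  the case \<open>B = {}\<close> is irrelevant, since blocks of partitions are nonempty.
\<close>

definition is_lcm :: "'a::ab_group_add \<Rightarrow> 'a set \<Rightarrow> bool" where
  "is_lcm b B \<longleftrightarrow> group_closure {b} = (\<Inter>c\<in>B. group_closure {c})"

text \<open>Existence of least common multiples: a subgroup of a cyclic group is cyclic.\<close>

lemma cyclic_param:
  fixes c :: "'a::ab_group_add"
  obtains \<phi> :: "int \<Rightarrow> 'a" where "\<And>i j. \<phi> (i - j) = \<phi> i - \<phi> j" and "\<phi> 1 = c"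
proof -
  define m where "m n = ((+) c ^^ n) 0" for n
  have m_add: "m (i + j) = m i + m j" for i j
    by (induction i) (simp_all add: m_def algebra_simps)
  define \<phi> where "\<phi> k = m (nat k) - m (nat (- k))" for k :: int
  have \<phi>: "\<phi> (int i - int j) = m i - m j" for i j
  proof (cases "i \<le> j")
    case True
    then show ?thesis using m_add[of i "j - i"]
      by (simp add: \<phi>_def m_def nat_diff_distrib)
  next
    case False
    then show ?thesis using m_add[of j "i - j"]
      by (simp add: \<phi>_def m_def nat_diff_distrib)
  qed
  have "\<phi> (i - j) = \<phi> i - \<phi> j" for i j
  proof -
    obtain p q r s where ij: "i = int p - int q" "j = int r - int s"
      by (meson int_diff_cases)
    then have "i - j = int (p + s) - int (q + r)" by simp
    then have "\<phi> (i - j) = m (p + s) - m (q + r)" by (simp only: \<phi>)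
    also have "\<dots> = (m p - m q) - (m r - m s)" by (simp add: m_add)
    also have "\<dots> = \<phi> i - \<phi> j" by (simp only: ij \<phi>)
    finally show ?thesis .
  qed
  moreover have "\<phi> 1 = c" by (simp add: \<phi>_def m_def)
  ultimately show ?thesis using that by blast
qed

lemma group_closure_image:
  fixes \<phi> :: "int \<Rightarrow> 'a::ab_group_add"
  assumes "\<And>i j. \<phi> (i - j) = \<phi> i - \<phi> j"
  shows "group_closure {\<phi> d} = range (\<lambda>m. \<phi> (d * m))"
proof (intro equalityI subsetI)
  fix x assume "x \<in> group_closure {\<phi> d}"
  then show "x \<in> range (\<lambda>m. \<phi> (d * m))"
  proof induction
    case (base s)
    have "\<phi> 0 = 0" using assms[of 0 0] by simp
    then have "0 = \<phi> (d * 0)" "\<phi> d = \<phi> (d * 1)" by simp_all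
    with base show ?case by blast
  next
    case (diff s t)
    then show ?case by (auto simp flip: assms right_diff_distrib)
  qed
next
  fix x assume "x \<in> range (\<lambda>m. \<phi> (d * m))"
  then obtain m where x: "x = \<phi> (d * m)" by blast
  have "d * m \<in> group_closure {d}" by (simp add: group_closure_mult_left group_closure.base)
  then have "\<phi> (d * m) \<in> group_closure {\<phi> d}"
  proof induction
    case (base s)
    have "\<phi> 0 = 0" using assms[of 0 0] by simp
    with base show ?case by (auto intro: group_closure.base)
  next
    case (diff s t)
    then show ?case by (simp add: assms group_closure.diff)
  qed
  with x show "x \<in> group_closure {\<phi> d}" by simp
qed

lemma ex_is_lcm:
  fixes B :: "'a::ab_group_add set"
  assumes "B \<noteq> {}"
  shows "\<exists>b. is_lcm b B"
proof -
  obtain c where c: "c \<in> B" using assms by blast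
  obtain \<phi> :: "int \<Rightarrow> 'a" where \<phi>: "\<And>i j. \<phi> (i - j) = \<phi> i - \<phi> j" and "\<phi> 1 = c"
    using cyclic_param by blast
  define H where "H = (\<Inter>c\<in>B. group_closure {c})"
  define K where "K = \<phi> -` H"
  have \<phi>0: "\<phi> 0 = 0" using \<phi>[of 0 0] by simp
  have "group_closure K \<subseteq> K"
  proof
    fix k assume "k \<in> group_closure K"
    then show "k \<in> K"
      by induction (auto simp: K_def H_def \<phi> \<phi>0 intro: group_closure.diff)
  qed
  then have K: "K = range (times (Gcd K))"
    using group_closure.base[of _ K] group_closure_eq[of K] by blast
  have "H \<subseteq> range \<phi>"
    using c group_closure_image[of \<phi> 1, OF \<phi>] \<open>\<phi> 1 = c\<close> by (auto simp: H_def)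
  then have "H = \<phi> ` K" by (auto simp: K_def)
  also have "\<dots> = range (\<lambda>m. \<phi> (Gcd K * m))" by (subst K) (simp add: image_image)
  also have "\<dots> = group_closure {\<phi> (Gcd K)}" using group_closure_image[of \<phi>, OF \<phi>] by simp
  finally show ?thesis unfolding is_lcm_def H_def by metis
qed

end

theory Submission
  imports
    Defs
    "HOL-Computational_Algebra.Polynomial_Factorial"
    "HOL-Number_Theory.Cong"
begin

text \<open>
  Sufficiency is proved by induction on \<open>F = {a\<^sub>1, \<dots>, a\<^sub>n}\<close>, splitting off one class \<open>C\<close> of commensurable
  elements. These are multiples \<open>c = m\<^sub>c e\<close> of a common element; let \<open>M\<close> be the least common multiple of the
  \<open>m\<^sub>c\<close>, let \<open>R = F - C\<close>, and let \<open>X\<close> act as the shift by \<open>e\<close>. Partitions of \<open>F\<close> containing the block \<open>C\<close>,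
  or containing all singletons of \<open>C\<close>, show by induction that \<open>(X\<^sup>M - 1) f\<close> and \<open>D f\<close> decompose over \<open>R\<close>,
  where \<open>D = \<Prod>\<^sub>c (X^m\<^sub>c - 1)\<close>. Let \<open>P\<close> be the least common multiple of the \<open>X^m\<^sub>c - 1\<close> in \<open>\<int>[X]\<close>. A positive
  multiple of \<open>P\<close> lies in the ideal \<open>(D, X\<^sup>M - 1)\<close>, so a multiple of \<open>P f\<close> decomposes over \<open>R\<close>; since the
  partition condition for \<open>R\<close> is insensitive to multiples, so does \<open>P f\<close>. As \<open>P\<close> divides \<open>X\<^sup>M - 1\<close>, it maps
  the \<open>c\<close>-periodic functions onto themselves for \<open>c \<in> R\<close>. Hence \<open>P f = P r\<close> for some \<open>r\<close> decomposing over
  \<open>R\<close>, and it remains to see that \<open>ker P\<close> decomposes over \<open>C\<close>. Up to a multiple this is a polynomial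
  identity; the multiple is removed by means of sections of \<open>\<int>/M \<rightarrow> \<int>/m\<^sub>c\<close> that respect congruences
  modulo all divisors of \<open>M\<close>.
\<close>

subsection \<open>Integer multiples and periodic functions\<close>

text \<open>The choice among homomorphisms from \<open>int\<close> is harmless:
  \<open>cyclic_param\<close> provides one, and its value at 1 determines it.\<close>

definition imul :: "int \<Rightarrow> 'a::ab_group_add \<Rightarrow> 'a" where
  "imul k x = (SOME \<phi>. (\<forall>i j. \<phi> (i - j) = \<phi> i - \<phi> j) \<and> \<phi> 1 = x) k"

lemma imul_diff_left: "imul (i - j) x = imul i x - imul j x"
  and imul_1 [simp]: "imul 1 x = x"
proof -
  have "\<exists>\<phi>. (\<forall>i j. \<phi> (i - j) = \<phi> i - \<phi> j) \<and> \<phi> (1::int) = x"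
    using cyclic_param[of x] by metis
  from someI_ex[OF this] show "imul (i - j) x = imul i x - imul j x" "imul 1 x = x"
    unfolding imul_def by blast+
qed

lemma imul_0 [simp]: "imul 0 x = 0"
  using imul_diff_left[of 0 0 x] by simp

lemma imul_minus_left: "imul (- i) x = - imul i x"
  using imul_diff_left[of 0 i x] by simp

lemma imul_add_left: "imul (i + j) x = imul i x + imul j x"
  using imul_diff_left[of i "- j" x] by (simp add: imul_minus_left)

lemma imul_add_right: "imul k (x + y) = imul k x + imul k y"
  by (induction k rule: int_induct[where k=0]) (simp_all add: imul_add_left imul_diff_left)

lemma imul_0_right [simp]: "imul k 0 = 0"
  using imul_add_right[of k 0 0] by simp

lemma imul_minus_right: "imul k (- x) = - imul k x"
  using imul_add_right[of k x "- x"] by (simp add: eq_neg_iff_add_eq_0 add.commute)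

lemma imul_diff_right: "imul k (x - y) = imul k x - imul k y"
  using imul_add_right[of k x "- y"] by (simp add: imul_minus_right)

lemma imul_imul: "imul i (imul j x) = imul (i * j) x"
  by (induction i rule: int_induct[where k=0])
     (simp_all add: imul_add_left imul_diff_left algebra_simps)

lemma imul_nat_eq_funpow: "imul (int n) x = ((+) x ^^ n) 0"
  by (induction n) (simp_all add: imul_add_left)

lemma torsion_free_imul:
  fixes x :: "'a::ab_group_add"
  assumes "torsion_free TYPE('a)" "imul k x = 0" "k \<noteq> 0"
  shows "x = 0"
proof -
  have "imul (int (nat \<bar>k\<bar>)) x = 0"
    using assms(2) by (simp add: abs_if imul_minus_left)
  then show ?thesis
    using assms(1,3) unfolding imul_nat_eq_funpow torsion_free_def
    by (metis zero_less_abs_iff zero_less_nat_eq)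
qed

lemma group_closure_eq_range_imul: "group_closure {c} = range (\<lambda>k. imul k c)"
  using group_closure_image[of "\<lambda>k. imul k c" 1] by (simp add: imul_diff_left)

lemma is_lcm_single: "is_lcm c {c}"
  by (simp add: is_lcm_def)

lemma range_imul_uminus: "range (\<lambda>k. imul k (- c)) = range (\<lambda>k. imul k c)"
proof -
  have "imul k (- c) = imul (- k) c" for k
    by (simp add: imul_minus_left imul_minus_right)
  then have "range (\<lambda>k. imul k (- c)) = (\<lambda>k. imul k c) ` range uminus"
    by (simp only: image_image)
  moreover have "range uminus = (UNIV :: int set)"
    by (metis surjI minus_minus)
  ultimately show ?thesis by simp
qed

lemma is_lcm_uminus_single: "is_lcm (- c) {c}"
  by (simp add: is_lcm_def group_closure_eq_range_imul range_imul_uminus)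

lemma periodic_iff: "periodic a f \<longleftrightarrow> (\<forall>x. f (x + a) = f x)"
  by (auto simp: periodic_def diff_op_def fun_eq_iff)

lemma periodic_imul:
  assumes "periodic a f"
  shows "f (x + imul k a) = f x"
proof (induction k arbitrary: x rule: int_induct[where k=0])
  case (step1 i)
  have "f (x + imul (i + 1) a) = f ((x + imul i a) + a)"
    by (simp add: imul_add_left algebra_simps)
  then show ?case using step1 assms by (simp add: periodic_iff)
next
  case (step2 i)
  have "f (x + imul (i - 1) a) = f ((x + imul (i - 1) a) + a)"
    using assms by (simp add: periodic_iff)
  also have "\<dots> = f (x + imul i a)"
    by (simp add: imul_diff_left algebra_simps)
  finally show ?case using step2 by simp
qed simp

lemma periodic_multiple: "periodic a f \<Longrightarrow> periodic (imul k a) f"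
  using periodic_imul[of a f] by (simp add: periodic_iff)

lemma periodic_imul_abs:
  "periodic (imul \<bar>k\<bar> a) f \<longleftrightarrow> periodic (imul k a) f"
  using periodic_multiple[of "imul k a" f "-1"] periodic_multiple[of "imul (- k) a" f "-1"]
  by (auto simp: abs_if imul_minus_left imul_minus_right)

lemma periodic_0 [simp]: "periodic 0 f" and periodic_zero_fun [simp]: "periodic a (\<lambda>x. 0)"
  by (simp_all add: periodic_iff)

lemma periodic_add: "periodic a f \<Longrightarrow> periodic a g \<Longrightarrow> periodic a (\<lambda>x. f x + g x)"
  and periodic_diff: "periodic a f \<Longrightarrow> periodic a g \<Longrightarrow> periodic a (\<lambda>x. f x - g x)"
  by (simp_all add: periodic_iff)

subsection \<open>Integer polynomials acting by shifts\<close>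

text \<open>Horner scheme for the module structure over \<open>int poly\<close> in which X is the
  shift by \<open>e\<close>. Compositions of differences with steps in multiples of \<open>e\<close>
  become products of polynomials.\<close>

definition act :: "'a::ab_group_add \<Rightarrow> int poly \<Rightarrow> ('a \<Rightarrow> 'b::ab_group_add) \<Rightarrow> 'a \<Rightarrow> 'b" where
  "act e p f = fold_coeffs (\<lambda>k F x. imul k (f x) + F (x + e)) p (\<lambda>x. 0)"

lemma act_0 [simp]: "act e 0 f = (\<lambda>x. 0)"
  by (simp add: act_def)

lemma act_pCons [simp]: "act e (pCons k p) f = (\<lambda>x. imul k (f x) + act e p f (x + e))"
  by (cases "p = 0 \<and> k = 0") (auto simp: act_def)

lemma act_1 [simp]: "act e 1 f = f"
  by (simp add: one_pCons)

lemma act_add: "act e (p + q) f = (\<lambda>x. act e p f x + act e q f x)"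
  by (induction p q rule: poly_induct2) (auto simp: fun_eq_iff imul_add_left algebra_simps)

lemma act_smult: "act e (smult k p) f = (\<lambda>x. imul k (act e p f x))"
  by (induction p) (auto simp: fun_eq_iff imul_add_right imul_imul)

lemma act_mult: "act e (p * q) f = act e p (act e q f)"
  by (induction p) (auto simp: fun_eq_iff act_add act_smult)

lemma act_diff: "act e (p - q) f = (\<lambda>x. act e p f x - act e q f x)"
  using act_add[of e "p - q" q f] by (simp add: fun_eq_iff)

lemma act_sum: "act e (sum p A) f = (\<lambda>x. \<Sum>a\<in>A. act e (p a) f x)"
  by (induction A rule: infinite_finite_induct) (auto simp: act_add)

lemma act_fun_add: "act e p (\<lambda>x. f x + g x) = (\<lambda>x. act e p f x + act e p g x)"
  by (induction p) (auto simp: fun_eq_iff imul_add_right algebra_simps)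

lemma act_fun_0 [simp]: "act e p (\<lambda>x. 0) = (\<lambda>x. 0)"
  by (induction p) auto

lemma act_fun_diff: "act e p (\<lambda>x. f x - g x) = (\<lambda>x. act e p f x - act e p g x)"
  by (induction p) (auto simp: fun_eq_iff imul_diff_right algebra_simps)

lemma act_fun_sum: "act e p (\<lambda>x. \<Sum>a\<in>A. f a x) = (\<lambda>x. \<Sum>a\<in>A. act e p (f a) x)"
  by (induction A rule: infinite_finite_induct) (auto simp: act_fun_add)

lemma act_monom: "act e (monom 1 m) f = (\<lambda>x. f (x + imul (int m) e))"
  by (induction m) (auto simp: monom_0 monom_Suc fun_eq_iff imul_add_left algebra_simps)

lemma act_monom_minus_1: "act e (monom 1 m - 1) f = diff_op (imul (int m) e) f"
  by (simp add: act_diff act_monom diff_op_def)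

lemma periodic_act: "periodic a f \<Longrightarrow> periodic a (act e p f)"
proof (induction p)
  case (pCons k p)
  then have "act e p f (x + a + e) = act e p f (x + e)" for x
    unfolding periodic_iff by (metis add.assoc add.commute)
  with pCons show ?case by (simp add: periodic_iff)
qed simp

lemma foldr_diff_op_eq_act:
  "foldr diff_op (map (\<lambda>c. imul (int (m c)) e) cs) f
    = act e (\<Prod>c\<leftarrow>cs. monom 1 (m c) - 1) f"
  by (induction cs) (simp_all add: act_mult act_monom_minus_1)

subsection \<open>Decomposable functions\<close>

text \<open>Summands are indexed by the periods themselves, which suits induction on finite sets.
  Repetitions among the given elements are handled by \<open>decomposable_image_iff\<close>.\<close>

definition decomposable :: "'a::ab_group_add set \<Rightarrow> ('a \<Rightarrow> 'b::ab_group_add) \<Rightarrow> bool" where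
  "decomposable F f \<longleftrightarrow> (\<exists>g. (\<forall>c\<in>F. periodic c (g c)) \<and> f = (\<lambda>x. \<Sum>c\<in>F. g c x))"

lemma decomposableI:
  "(\<And>c. c \<in> F \<Longrightarrow> periodic c (g c)) \<Longrightarrow> decomposable F (\<lambda>x. \<Sum>c\<in>F. g c x)"
  unfolding decomposable_def by blast

lemma decomposableE:
  assumes "decomposable F f"
  obtains g where "\<forall>c\<in>F. periodic c (g c)" "f = (\<lambda>x. \<Sum>c\<in>F. g c x)"
  using assms unfolding decomposable_def by blast

lemma decomposable_add:
  assumes "decomposable F f" "decomposable F g"
  shows "decomposable F (\<lambda>x. f x + g x)"
proof -
  obtain u where "\<forall>c\<in>F. periodic c (u c)" "f = (\<lambda>x. \<Sum>c\<in>F. u c x)"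
    using assms(1) by (rule decomposableE)
  moreover obtain v where "\<forall>c\<in>F. periodic c (v c)" "g = (\<lambda>x. \<Sum>c\<in>F. v c x)"
    using assms(2) by (rule decomposableE)
  ultimately show ?thesis
    using decomposableI[of F "\<lambda>c x. u c x + v c x"] by (simp add: periodic_add sum.distrib)
qed

lemma decomposable_act:
  assumes "decomposable F f"
  shows "decomposable F (act e p f)"
proof -
  obtain u where "\<forall>c\<in>F. periodic c (u c)" "f = (\<lambda>x. \<Sum>c\<in>F. u c x)"
    using assms by (rule decomposableE)
  then show ?thesis
    using decomposableI[of F "\<lambda>c. act e p (u c)"] by (simp add: periodic_act act_fun_sum)
qed

lemma decomposable_Un:
  assumes "decomposable F f" "decomposable G g" "finite F" "finite G" "F \<inter> G = {}"
  shows "decomposable (F \<union> G) (\<lambda>x. f x + g x)"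
proof -
  obtain u where u: "\<forall>c\<in>F. periodic c (u c)" "f = (\<lambda>x. \<Sum>c\<in>F. u c x)"
    using assms(1) by (rule decomposableE)
  obtain v where v: "\<forall>c\<in>G. periodic c (v c)" "g = (\<lambda>x. \<Sum>c\<in>G. v c x)"
    using assms(2) by (rule decomposableE)
  define w where "w c = (if c \<in> F then u c else v c)" for c
  have "f = (\<lambda>x. \<Sum>c\<in>F. w c x)"
    unfolding u(2) w_def by (intro ext sum.cong) auto
  moreover have "g = (\<lambda>x. \<Sum>c\<in>G. w c x)"
    unfolding v(2) w_def using assms(5) by (intro ext sum.cong) auto
  ultimately have "(\<lambda>x. f x + g x) = (\<lambda>x. \<Sum>c\<in>F \<union> G. w c x)"
    using assms(3-5) by (simp add: sum.union_disjoint)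
  moreover have "c \<in> F \<union> G \<Longrightarrow> periodic c (w c)" for c
    using u(1) v(1) by (auto simp: w_def)
  ultimately show ?thesis
    using decomposableI[of "F \<union> G" w] by simp
qed

lemma decomposable_single: "periodic c f \<Longrightarrow> decomposable {c} f"
  using decomposableI[of "{c}" "\<lambda>_. f"] by simp

lemma decomposable_insertI:
  assumes "decomposable F f" "periodic c g" "finite F" "c \<notin> F"
  shows "decomposable (insert c F) (\<lambda>x. f x + g x)"
  using decomposable_Un[OF assms(1) decomposable_single[OF assms(2)]] assms(3,4) by simp

lemma decomposable_insertE:
  assumes "decomposable (insert c F) f" "finite F" "c \<notin> F"
  obtains s g where "decomposable F s" "periodic c g" "f = (\<lambda>x. s x + g x)"
proof -
  obtain u where u: "\<forall>d\<in>insert c F. periodic d (u d)"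
    "f = (\<lambda>x. \<Sum>d\<in>insert c F. u d x)"
    using assms(1) by (rule decomposableE)
  show ?thesis
    by (rule that[of "\<lambda>x. \<Sum>d\<in>F. u d x" "u c"])
       (use u assms(2,3) in \<open>auto intro!: decomposableI simp: add.commute\<close>)
qed

lemma decomposable_zero_mem:
  assumes "finite F" "0 \<in> F"
  shows "decomposable F f"
  using decomposableI[of F "\<lambda>c. if c = 0 then f else (\<lambda>x. 0)"] assms
  by (simp add: if_distrib[of "\<lambda>h. h _"] sum.delta' cong: if_cong)

text \<open>From left to right, one index per period carries the summand and all others get the zero
  function. From right to left, summands with equal periods are added up.\<close>

lemma decomposable_image_iff:
  assumes "finite I"
  shows "decomposable (a ` I) f \<longleftrightarrow>
    (\<exists>g. (\<forall>j\<in>I. periodic (a j) (g j)) \<and> f = (\<lambda>x. \<Sum>j\<in>I. g j x))"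
proof
  assume "decomposable (a ` I) f"
  then obtain u where u: "\<forall>c\<in>a ` I. periodic c (u c)" "f = (\<lambda>x. \<Sum>c\<in>a ` I. u c x)"
    by (rule decomposableE)
  obtain J where J: "J \<subseteq> I" "inj_on a J" "a ` I = a ` J"
    by (meson order_refl subset_image_inj)
  define g where "g j = (if j \<in> J then u (a j) else (\<lambda>x. 0))" for j
  have "(\<Sum>c\<in>a ` I. u c x) = (\<Sum>j\<in>I. g j x)" for x
    unfolding J(3) sum.reindex[OF J(2)]
    by (rule sum.mono_neutral_cong_left) (use J assms in \<open>auto simp: g_def\<close>)
  then show "\<exists>g. (\<forall>j\<in>I. periodic (a j) (g j)) \<and> f = (\<lambda>x. \<Sum>j\<in>I. g j x)"
    using u by (intro exI[of _ g]) (auto simp: g_def)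
next
  assume "\<exists>g. (\<forall>j\<in>I. periodic (a j) (g j)) \<and> f = (\<lambda>x. \<Sum>j\<in>I. g j x)"
  then obtain g where g: "\<And>j. j \<in> I \<Longrightarrow> periodic (a j) (g j)" "f = (\<lambda>x. \<Sum>j\<in>I. g j x)"
    by blast
  have "f = (\<lambda>x. \<Sum>c\<in>a ` I. \<Sum>j\<in>{j \<in> I. a j = c}. g j x)"
    unfolding g(2) using sum.image_gen[OF assms] by blast
  moreover have "periodic c (\<lambda>x. \<Sum>j\<in>{j \<in> I. a j = c}. g j x)" for c
    using g(1) by (auto simp: periodic_iff intro!: sum.cong)
  ultimately show "decomposable (a ` I) f"
    unfolding decomposable_def by (intro exI[of _ "\<lambda>c x. \<Sum>j\<in>{j \<in> I. a j = c}. g j x"]) auto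
qed

subsection \<open>Necessity of the difference equations\<close>

definition partition_cond :: "'a::ab_group_add set \<Rightarrow> ('a \<Rightarrow> 'b::ab_group_add) \<Rightarrow> bool" where
  "partition_cond F f \<longleftrightarrow> (\<forall>Bs bs. distinct Bs \<longrightarrow> partition_on F (set Bs) \<longrightarrow>
     list_all2 is_lcm bs Bs \<longrightarrow> foldr diff_op bs f = (\<lambda>x. 0))"

lemma foldr_diff_op_0 [simp]: "foldr diff_op bs (\<lambda>x. 0) = (\<lambda>x. 0)"
  by (induction bs) (simp_all add: diff_op_def)

lemma foldr_diff_op_sum:
  "foldr diff_op bs (\<lambda>x. \<Sum>c\<in>F. g c x) = (\<lambda>x. \<Sum>c\<in>F. foldr diff_op bs (g c) x)"
  by (induction bs) (simp_all add: diff_op_def sum_subtractf)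

lemma foldr_diff_op_imul:
  "foldr diff_op bs (\<lambda>x. imul k (f x)) = (\<lambda>x. imul k (foldr diff_op bs f x))"
  by (induction bs) (simp_all add: diff_op_def imul_diff_right)

lemma periodic_foldr_diff_op: "periodic c f \<Longrightarrow> periodic c (foldr diff_op bs f)"
  by (induction bs) (auto simp: diff_op_def periodic_iff algebra_simps, metis add.assoc add.commute)

lemma foldr_diff_op_periodic:
  assumes "periodic c g" "imul k c \<in> set bs"
  shows "foldr diff_op bs g = (\<lambda>x. 0)"
  using assms(2)
proof (induction bs)
  case (Cons b bs)
  show ?case
  proof (cases "b = imul k c")
    case True
    then show ?thesis
      using periodic_multiple[OF periodic_foldr_diff_op[OF assms(1)]] by (simp add: periodic_def)
  next
    case False
    then show ?thesis using Cons by (simp add: diff_op_def)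
  qed
qed simp

text \<open>Each \<open>c\<close> lies in some block, whose least common multiple is a multiple of
  \<open>c\<close>. The difference belonging to that block kills the \<open>c\<close>-periodic
  summand, and the other differences preserve periodicity.\<close>

lemma decomposable_imp_partition_cond:
  assumes "decomposable F f"
  shows "partition_cond F f"
  unfolding partition_cond_def
proof (intro allI impI)
  fix Bs bs
  assume part: "partition_on F (set Bs)" and lcm: "list_all2 is_lcm bs Bs"
  obtain g where g: "\<forall>c\<in>F. periodic c (g c)" "f = (\<lambda>x. \<Sum>c\<in>F. g c x)"
    using assms by (rule decomposableE)
  have "foldr diff_op bs (g c) = (\<lambda>x. 0)" if c: "c \<in> F" for c
  proof -
    obtain i where i: "i < length Bs" "c \<in> Bs ! i"
      using part c by (metis UnionE in_set_conv_nth partition_onD1)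
    then have "is_lcm (bs ! i) (Bs ! i)"
      using lcm by (simp add: list_all2_conv_all_nth)
    then have "bs ! i \<in> group_closure {c}"
      using i(2) group_closure.base[of "bs ! i" "{bs ! i}"] unfolding is_lcm_def by blast
    then obtain k where "bs ! i = imul k c"
      unfolding group_closure_eq_range_imul by blast
    moreover have "bs ! i \<in> set bs"
      using i(1) lcm by (simp add: list_all2_conv_all_nth)
    ultimately show ?thesis
      using foldr_diff_op_periodic[OF bspec[OF g(1) c]] by metis
  qed
  then show "foldr diff_op bs f = (\<lambda>x. 0)"
    unfolding g(2) foldr_diff_op_sum by simp
qed

subsection \<open>Coordinates along a cyclic subgroup\<close>

text \<open>The hypothesis says that \<open>b\<close> has infinite order modulo the subgroup
  generated by \<open>c\<close>. So \<open>\<pi>\<close> can be the \<open>b\<close>-coordinate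
  relative to a representative chosen in each coset of the subgroup generated by \<open>b\<close>
  and \<open>c\<close>.\<close>

lemma ex_coordinate:
  fixes b c :: "'a::ab_group_add"
  assumes "\<And>i j. imul i c = imul j b \<Longrightarrow> j = 0"
  shows "\<exists>\<pi> :: 'a \<Rightarrow> int. \<forall>x. \<pi> (x + b) = \<pi> x + 1 \<and> \<pi> (x + c) = \<pi> x"
proof -
  define E where "E x = {x + imul i c + imul j b | i j. True}" for x
  \<comment> \<open>The choice depends on the coset \<open>E x\<close> only, so all its points share
    one representative.\<close>
  define rep where "rep x = (SOME y. y \<in> E x)" for x
  define is_coord where "is_coord x j \<longleftrightarrow> (\<exists>i. x = rep x + imul i c + imul j b)" for x j
  define \<pi> where "\<pi> x = (SOME j. is_coord x j)" for x
  have shift: "E (x + imul i c + imul j b) = E x" for x i j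
  proof -
    have "x + imul i c + imul j b + imul i' c + imul j' b =
        x + imul (i + i') c + imul (j + j') b"
      "x + imul i' c + imul j' b =
        x + imul i c + imul j b + imul (i' - i) c + imul (j' - j) b" for i' j'
      by (simp_all add: imul_add_left imul_diff_left)
    then show ?thesis unfolding E_def by blast
  qed
  have E_b: "E (x + b) = E x" and E_c: "E (x + c) = E x" for x
    using shift[of x 0 1] shift[of x 1 0] by simp_all
  have ex: "\<exists>j. is_coord x j" for x
  proof -
    have "x \<in> E x" unfolding E_def by (auto intro!: exI[of _ 0])
    then have "rep x \<in> E x" unfolding rep_def by (metis someI)
    then obtain i j where "rep x = x + imul i c + imul j b" unfolding E_def by blast
    then have "x = rep x + imul (- i) c + imul (- j) b"
      by (simp add: imul_minus_left)
    then show ?thesis unfolding is_coord_def by blast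
  qed
  have uniq: "j = j'" if "is_coord x j" "is_coord x j'" for x j j'
  proof -
    obtain i i' where "rep x + imul i c + imul j b = rep x + imul i' c + imul j' b"
      using \<open>is_coord x j\<close> \<open>is_coord x j'\<close> unfolding is_coord_def by metis
    then have "imul (i - i') c = imul (j' - j) b"
      by (simp add: imul_diff_left algebra_simps)
    from assms[OF this] show ?thesis by simp
  qed
  have coord: "is_coord x (\<pi> x)" for x
    unfolding \<pi>_def using ex by (metis someI_ex)
  have \<pi>_eq: "is_coord x j \<Longrightarrow> \<pi> x = j" for x j
    using coord uniq by blast
  have "\<pi> (x + b) = \<pi> x + 1 \<and> \<pi> (x + c) = \<pi> x" for x
  proof -
    obtain i where i: "x = rep x + imul i c + imul (\<pi> x) b"
      using coord unfolding is_coord_def by blast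
    have "rep (x + b) = rep x" "rep (x + c) = rep x"
      by (simp_all add: rep_def E_b E_c)
    moreover have "x + b = rep x + imul i c + imul (\<pi> x + 1) b"
      by (subst i) (simp add: imul_add_left)
    moreover have "x + c = rep x + imul (i + 1) c + imul (\<pi> x) b"
      by (subst i) (simp add: imul_add_left)
    ultimately have "is_coord (x + b) (\<pi> x + 1)" "is_coord (x + c) (\<pi> x)"
      unfolding is_coord_def by metis+
    then show ?thesis using \<pi>_eq by blast
  qed
  then show ?thesis by blast
qed

lemma coordinate_imul:
  fixes \<pi> :: "'a::ab_group_add \<Rightarrow> int"
  assumes "\<And>x. \<pi> (x + e) = \<pi> x + 1"
  shows "\<pi> (x + imul k e) = \<pi> x + k"
proof (induction k rule: int_induct[where k=0])
  case (step1 i)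
  then show ?case using assms[of "x + imul i e"] by (simp add: imul_add_left algebra_simps)
next
  case (step2 i)
  then show ?case using assms[of "x + imul (i - 1) e"] by (simp add: imul_diff_left algebra_simps)
qed simp

lemma ex_antidifference:
  fixes \<gamma> :: "int \<Rightarrow> 'b::ab_group_add"
  shows "\<exists>G. \<forall>j. G (j + 1) - G j = \<gamma> j"
proof (intro exI allI)
  \<comment> \<open>At most one of the two sums is nonempty, so the recurrence also holds across
    0.\<close>
  define G where "G j = (\<Sum>k\<in>{0..<j}. \<gamma> k) - (\<Sum>k\<in>{j..<0}. \<gamma> k)" for j
  fix j
  show "G (j + 1) - G j = \<gamma> j"
  proof (cases "j \<ge> 0")
    case True
    then have "{0..<j + 1} = insert j {0..<j}" by auto
    with True show ?thesis by (simp add: G_def)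
  next
    case False
    then have "{j..<0} = insert j {j + 1..<0}" by auto
    with False show ?thesis by (simp add: G_def)
  qed
qed

text \<open>The equation is solved by summation along the orbits of \<open>b\<close>. The solution
  stays \<open>c\<close>-periodic because both \<open>g\<close> and the coordinate
  \<open>\<pi>\<close> are invariant under \<open>c\<close>.\<close>

lemma diff_op_surj_periodic:
  fixes g :: "'a::ab_group_add \<Rightarrow> 'b::ab_group_add"
  assumes "\<And>i j. imul i c = imul j b \<Longrightarrow> j = 0" and "periodic c g"
  shows "\<exists>h. periodic c h \<and> diff_op b h = g"
proof -
  obtain \<pi> :: "'a \<Rightarrow> int" where \<pi>: "\<And>x. \<pi> (x + b) = \<pi> x + 1" "\<And>x. \<pi> (x + c) = \<pi> x"
    using ex_coordinate[of c b] assms(1) by blast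
  obtain G :: "(int \<Rightarrow> 'b) \<Rightarrow> int \<Rightarrow> 'b" where G: "\<And>\<gamma> j. G \<gamma> (j + 1) - G \<gamma> j = \<gamma> j"
    using ex_antidifference by metis
  \<comment> \<open>The values of \<open>g\<close> along the orbit of \<open>x\<close>, indexed by
    absolute coordinate rather than by distance from \<open>x\<close>. Hence \<open>x\<close> and
    \<open>x + b\<close> give the same sequence, and \<open>G\<close> assigns them the same
    antidifference.\<close>
  define \<gamma> where "\<gamma> x k = g (x + imul (k - \<pi> x) b)" for x k
  define h where "h x = G (\<gamma> x) (\<pi> x)" for x
  have shift: "b + imul (k - (\<pi> x + 1)) b = imul (k - \<pi> x) b" for x k
    by (simp add: imul_diff_left imul_add_left)
  have "\<gamma> (x + b) = \<gamma> x" for x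
    by (rule ext) (simp only: \<gamma>_def \<pi> add.assoc shift)
  then have "diff_op b h = g"
    by (simp add: diff_op_def h_def \<pi> G) (simp add: \<gamma>_def)
  moreover have "g (x + c + y) = g (x + y)" for x y
    using assms(2) unfolding periodic_iff by (metis add.assoc add.commute)
  then have "\<gamma> (x + c) = \<gamma> x" for x
    by (intro ext) (simp add: \<gamma>_def \<pi>)
  then have "periodic c h"
    by (simp add: periodic_iff h_def \<pi>)
  ultimately show ?thesis by blast
qed

subsection \<open>Saturation along a cyclic subgroup\<close>

lemma cong_by_prime_powers:
  fixes x y :: int and k :: nat
  assumes "k > 0" and "\<And>p. prime p \<Longrightarrow> [x = y] (mod int (p ^ multiplicity p k))"
  shows "[x = y] (mod int k)"
proof -
  have "k dvd nat \<bar>x - y\<bar>"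
  proof (cases "x = y")
    case False
    show ?thesis
    proof (rule multiplicity_le_imp_dvd)
      fix p :: nat assume p: "prime p"
      have "int (p ^ multiplicity p k) dvd \<bar>x - y\<bar>"
        using assms(2)[OF p] by (simp add: cong_iff_dvd_diff)
      then have "p ^ multiplicity p k dvd nat \<bar>x - y\<bar>"
        by (metis abs_ge_zero int_dvd_int_iff int_nat_eq)
      then show "multiplicity p k \<le> multiplicity p (nat \<bar>x - y\<bar>)"
        using False p by (intro multiplicity_geI) (auto simp: prime_gt_Suc_0_nat)
    qed (use assms(1) in simp)
  qed simp
  then have "int k dvd \<bar>x - y\<bar>"
    by (metis abs_ge_zero int_dvd_int_iff int_nat_eq)
  then show ?thesis by (simp add: cong_iff_dvd_diff)
qed

text \<open>
  On the \<open>p\<close>-primary component of \<open>\<int>/M\<close> the section picks the representative of \<open>x\<close> modulo the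
  \<open>p\<close>-part of \<open>m\<close> in \<open>{0..<p^v}\<close>; the components are glued by the Chinese remainder theorem. An
  arbitrary section of \<open>\<int>/M \<rightarrow> \<int>/m\<close> would not respect congruences modulo the other divisors of
  \<open>M\<close>.
\<close>

lemma ex_residue_section:
  fixes m M :: nat
  assumes "M > 0" "m dvd M"
  shows "\<exists>s :: int \<Rightarrow> int. (\<forall>x y. [x = y] (mod int m) \<longrightarrow> [s x = s y] (mod int M)) \<and>
    (\<forall>x. [s x = x] (mod int m)) \<and>
    (\<forall>k x y. k dvd M \<longrightarrow> [x = y] (mod int k) \<longrightarrow> [s x = s y] (mod int k))"
proof -
  define u where "u x p = nat (x mod int (p ^ multiplicity p m))" for x p
  have "\<exists>z. \<forall>p\<in>prime_factors M. [z = u x p] (mod p ^ multiplicity p M)" for x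
  proof (rule chinese_remainder_nat)
    show "\<forall>p\<in>prime_factors M. \<forall>q\<in>prime_factors M. p \<noteq> q \<longrightarrow>
        coprime (p ^ multiplicity p M) (q ^ multiplicity q M)"
      by (auto simp: in_prime_factors_iff primes_coprime intro!: coprime_power_left_iff[THEN iffD2]
          coprime_power_right_iff[THEN iffD2])
  qed simp
  then obtain z where z: "\<And>x p. p \<in> prime_factors M \<Longrightarrow> [z x = u x p] (mod p ^ multiplicity p M)"
    by metis
  define s where "s x = int (z x)" for x
  have m0: "m > 0" using assms by (auto intro: Nat.gr0I)
  have s: "[s x = x mod int (p ^ multiplicity p m)] (mod int (p ^ multiplicity p M))"
    if "prime p" for x p
  proof (cases "p \<in> prime_factors M")
    case True
    have "x mod int (p ^ multiplicity p m) = int (u x p)"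
      using that by (simp add: u_def prime_gt_0_nat)
    then show ?thesis
      using z[OF True] by (simp only: s_def cong_int_iff)
  next
    case False
    then have "multiplicity p M = 0"
      using that assms(1) by (simp add: in_prime_factors_iff not_dvd_imp_multiplicity_0)
    then show ?thesis by simp
  qed
  have le: "multiplicity p k \<le> multiplicity p M" if "k dvd M" for p k :: nat
    using that assms(1) by (intro dvd_imp_multiplicity_le) auto
  have dvd: "int (p ^ i) dvd int (p ^ j)" if "i \<le> j" for p i j :: nat
    using that by (simp add: le_imp_power_dvd)
  have s_self: "[s x = x] (mod int (p ^ multiplicity p m))" if "prime p" for x p
  proof -
    have "[s x = x mod int (p ^ multiplicity p m)] (mod int (p ^ multiplicity p m))"
      using s[OF that] dvd[OF le[OF assms(2)]] by (rule cong_dvd_modulus)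
    then show ?thesis by (simp add: cong_def)
  qed
  have s_cong: "[s x = s y] (mod int (p ^ multiplicity p M))"
    if "prime p" "[x = y] (mod int (p ^ multiplicity p m))" for x y p
    using s[OF that(1), of x] s[OF that(1), of y] that(2) by (simp add: cong_def)
  have "[s x = s y] (mod int M)" if "[x = y] (mod int m)" for x y
    using assms(1)
  proof (rule cong_by_prime_powers)
    fix p :: nat assume "prime p"
    moreover have "int (p ^ multiplicity p m) dvd int m"
      by (simp only: int_dvd_int_iff multiplicity_dvd)
    with that have "[x = y] (mod int (p ^ multiplicity p m))"
      by (rule cong_dvd_modulus)
    ultimately show "[s x = s y] (mod int (p ^ multiplicity p M))"
      by (rule s_cong)
  qed
  moreover have "[s x = x] (mod int m)" for x
    using m0 s_self by (rule cong_by_prime_powers)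
  moreover have "[s x = s y] (mod int k)" if k: "k dvd M" and xy: "[x = y] (mod int k)" for k x y
  proof (rule cong_by_prime_powers)
    show "k > 0" using k assms(1) by (auto intro: Nat.gr0I)
    fix p :: nat assume p: "prime p"
    have "int (p ^ multiplicity p k) dvd int k"
      by (simp only: int_dvd_int_iff multiplicity_dvd)
    with xy have xy': "[x = y] (mod int (p ^ multiplicity p k))"
      by (rule cong_dvd_modulus)
    show "[s x = s y] (mod int (p ^ multiplicity p k))"
    \<comment> \<open>If the \<open>p\<close>-part of \<open>k\<close> divides that of
      \<open>m\<close>, then \<open>s\<close> is the identity modulo it. Otherwise \<open>x\<close>
      and \<open>y\<close> agree modulo the \<open>p\<close>-part of \<open>m\<close>, so their
      images agree even modulo that of \<open>M\<close>.\<close>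
    proof (cases "multiplicity p k \<le> multiplicity p m")
      case True
      have "[s w = w] (mod int (p ^ multiplicity p k))" for w
        using s_self[OF p] dvd[OF True] by (rule cong_dvd_modulus)
      then show ?thesis using xy' by (meson cong_sym cong_trans)
    next
      case False
      then have "[x = y] (mod int (p ^ multiplicity p m))"
        using xy' dvd by (meson cong_dvd_modulus nat_le_linear)
      from s_cong[OF p this] dvd[OF le[OF k]] show ?thesis by (rule cong_dvd_modulus)
    qed
  qed
  ultimately show ?thesis by blast
qed

lemma periodic_cong:
  assumes "periodic (imul k e) h" "[i = j] (mod k)"
  shows "h (x + imul i e) = h (x + imul j e)"
proof -
  obtain l where "i = j + l * k"
    using assms(2) by (metis cong_iff_lin cong_sym mult.commute)
  then have "x + imul i e = x + imul j e + imul l (imul k e)"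
    by (simp add: imul_add_left imul_imul)
  then show ?thesis by (simp only: periodic_imul[OF assms(1)])
qed

text \<open>The operator \<open>E\<close> below replaces averaging over multiples of
  \<open>c\<close>, which would need division. It makes \<open>f\<close> \<open>c\<close>-periodic,
  fixes \<open>c\<close>-periodic functions and preserves the other periods in question, so passing
  to \<open>f - E f\<close> removes the summand for \<open>c\<close>.\<close>

lemma decomposable_saturated_cyclic:
  fixes f :: "'a::ab_group_add \<Rightarrow> 'b::ab_group_add" and \<kappa> :: "'a \<Rightarrow> int"
  assumes "torsion_free TYPE('b)" and e: "\<And>k. imul k e = 0 \<Longrightarrow> k = 0"
    and "M > 0" "finite C" "\<And>c. c \<in> C \<Longrightarrow> c = imul (\<kappa> c) e \<and> \<kappa> c dvd int M"
    and "N \<noteq> 0" "periodic (imul (int M) e) f" "decomposable C (\<lambda>x. imul N (f x))"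
  shows "decomposable C f"
  using assms(4,5,7,8)
proof (induction C arbitrary: f rule: finite_induct)
  case empty
  then have "imul N (f x) = 0" for x
    by (simp add: decomposable_def fun_eq_iff)
  then show ?case
    using torsion_free_imul[OF assms(1)] \<open>N \<noteq> 0\<close> by (auto simp: decomposable_def)
next
  case (insert c C)
  \<comment> \<open>The instance \<open>c = 0\<close> of \<open>ex_coordinate\<close>: only the
    position along \<open>e\<close> matters.\<close>
  obtain \<pi> :: "'a \<Rightarrow> int" where "\<And>x. \<pi> (x + e) = \<pi> x + 1"
    using ex_coordinate[of 0 e] e by auto
  then have \<pi>: "\<pi> (x + imul k e) = \<pi> x + k" for x k
    by (rule coordinate_imul)
  define m where "m = nat \<bar>\<kappa> c\<bar>"
  have m: "m dvd M" "periodic c h \<longleftrightarrow> periodic (imul (int m) e) h" for h :: "'a \<Rightarrow> 'b"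
    using insert.prems(1)[of c] periodic_imul_abs[of "\<kappa> c" e h]
    by (auto simp: m_def simp flip: int_dvd_int_iff)
  obtain s :: "int \<Rightarrow> int" where s: "\<And>x y. [x = y] (mod int m) \<Longrightarrow> [s x = s y] (mod int M)"
    "\<And>x. [s x = x] (mod int m)"
    "\<And>k x y. k dvd M \<Longrightarrow> [x = y] (mod int k) \<Longrightarrow> [s x = s y] (mod int k)"
    using ex_residue_section[OF \<open>M > 0\<close> m(1)] by blast
  \<comment> \<open>Evaluates \<open>h\<close> at the point of the line through \<open>x\<close> in
    direction \<open>e\<close> whose coordinate is \<open>s (\<pi> x)\<close>.\<close>
  define E :: "('a \<Rightarrow> 'b) \<Rightarrow> 'a \<Rightarrow> 'b" where "E h x = h (x + imul (s (\<pi> x) - \<pi> x) e)" for h x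
  have E_periodic: "periodic (imul d e) (E h)"
    if "periodic (imul k e) h" "\<And>x. [s (x + d) = s x] (mod k)" for h d k
    unfolding periodic_iff
  proof
    fix x
    have "E h (x + imul d e) = h (x + imul (s (\<pi> x + d) - \<pi> x) e)"
      by (simp add: E_def \<pi> imul_diff_left imul_add_left)
    also have "\<dots> = E h x"
      unfolding E_def using that by (intro periodic_cong) (auto intro: cong_diff)
    finally show "E h (x + imul d e) = E h x" .
  qed
  have E_divisor: "periodic (imul k e) (E h)" if "k dvd int M" "periodic (imul k e) h" for k h
  proof -
    have "[s (x + k) = s x] (mod k)" for x
      using s(3)[of "nat \<bar>k\<bar>" "x + k" x] that(1)
      by (simp add: cong_iff_dvd_diff nat_abs_dvd_iff)
    with that(2) show ?thesis by (rule E_periodic)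
  qed
  have E_c: "periodic c (E f)"
    unfolding m(2) using insert.prems(2)
    by (rule E_periodic) (rule s(1), simp add: cong_def)
  have E_fix: "E h = h" if "periodic c h" for h
    unfolding E_def using periodic_cong[of "int m" e h _ 0] that m(2) s(2)
    by (simp add: cong_iff_dvd_diff)
  obtain t g where t: "decomposable C t" and g: "periodic c g"
    and N: "(\<lambda>x. imul N (f x)) = (\<lambda>x. t x + g x)"
    using insert.prems(3) insert.hyps by (rule decomposable_insertE)
  define f1 where "f1 x = f x - E f x" for x
  have "decomposable C f1"
  proof (rule insert.IH)
    show "periodic (imul (int M) e) f1"
      unfolding f1_def using insert.prems(2) E_divisor by (intro periodic_diff) auto
    obtain v where v: "\<forall>d\<in>C. periodic d (v d)" "t = (\<lambda>x. \<Sum>d\<in>C. v d x)"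
      using t by (rule decomposableE)
    have "imul N (f1 x) = t x - E t x" for x
    proof -
      have "imul N (f1 x) = (t x + g x) - (E t x + E g x)"
        using N by (simp add: f1_def E_def imul_diff_right fun_eq_iff)
      then show ?thesis using E_fix[OF g] by simp
    qed
    then have "(\<lambda>x. imul N (f1 x)) = (\<lambda>x. \<Sum>d\<in>C. v d x - E (v d) x)"
      by (simp add: v(2) E_def sum_subtractf)
    moreover have "periodic d (\<lambda>x. v d x - E (v d) x)" if "d \<in> C" for d
      using v(1) that insert.prems(1)[of d] E_divisor[of "\<kappa> d" "v d"]
      by (auto intro!: periodic_diff)
    ultimately show "decomposable C (\<lambda>x. imul N (f1 x))"
      using decomposableI[of C "\<lambda>d x. v d x - E (v d) x"] by simp
  qed (use insert.prems in blast)
  then have "decomposable (insert c C) (\<lambda>x. f1 x + E f x)"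
    using E_c insert.hyps by (rule decomposable_insertI)
  then show ?case by (simp add: f1_def)
qed

subsection \<open>Polynomial identities\<close>

text \<open>Expanding the product of the \<open>q c * u c + A c\<close>, only one term contains no
  factor \<open>A c\<close>, and it is a multiple of \<open>prod q C\<close>.\<close>

lemma prod_eq_combination:
  fixes k q u A :: "'i \<Rightarrow> 'r::comm_ring_1"
  assumes "finite C" "\<And>c. c \<in> C \<Longrightarrow> k c = q c * u c + A c"
  shows "\<exists>U V. prod k C = U * prod q C + (\<Sum>c\<in>C. V c * A c)"
  using assms
proof (induction C rule: finite_induct)
  case (insert c C)
  then obtain U V where UV: "prod k C = U * prod q C + (\<Sum>d\<in>C. V d * A d)" by auto
  define W where "W d = (if d = c then prod k C else V d * q c * u c)" for d
  have "(\<Sum>d\<in>C. W d * A d) = (\<Sum>d\<in>C. V d * A d) * (q c * u c)"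
    unfolding sum_distrib_right using insert.hyps(2) by (intro sum.cong) (auto simp: W_def)
  then have "prod k (insert c C) =
      (U * u c) * prod q (insert c C) + (\<Sum>d\<in>insert c C. W d * A d)"
    using insert.hyps insert.prems[of c] UV by (simp add: W_def algebra_simps)
  then show ?case by blast
qed (auto intro: exI[of _ 1])

text \<open>With \<open>y\<close> the \<open>m\<close>-th power of X, the cofactor of
  \<open>y - 1\<close> is a geometric sum of \<open>M div m\<close> powers of \<open>y\<close>, each
  congruent to 1 modulo \<open>y - 1\<close>.\<close>

lemma monom_minus_1_complement:
  assumes "m dvd M"
  shows "\<exists>u A :: int poly. A * (monom 1 m - 1) = monom 1 M - 1 \<and>
    of_nat (M div m) = (monom 1 m - 1) * u + A"
proof -
  define y :: "int poly" where "y = monom 1 m"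
  define A where "A = (\<Sum>i<M div m. y ^ i)"
  have M: "y ^ (M div m) = monom 1 M"
    using assms by (simp add: y_def monom_power)
  have "y - 1 dvd A - of_nat (M div m)"
  proof -
    have "A - of_nat (M div m) = (\<Sum>i<M div m. y ^ i - 1)"
      by (simp add: A_def sum_subtractf)
    also have "y - 1 dvd \<dots>"
      by (intro dvd_sum) (simp add: power_diff_1_eq)
    finally show ?thesis .
  qed
  then obtain u where "A - of_nat (M div m) = (y - 1) * u" by blast
  then have "of_nat (M div m) = (y - 1) * (- u) + A" by (simp add: algebra_simps)
  moreover have "A * (y - 1) = monom 1 M - 1"
    by (simp add: A_def M[symmetric] power_diff_1_eq mult.commute)
  ultimately show ?thesis unfolding y_def by blast
qed

text \<open>Multiplying the previous identities over \<open>C\<close> puts a positive integer, the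
  product of the \<open>M div m c\<close>, into the ideal generated by the full product and the
  cofactors.\<close>

lemma monom_minus_1_combination:
  fixes m :: "'i \<Rightarrow> nat"
  assumes "finite C" "M > 0" "\<And>c. c \<in> C \<Longrightarrow> m c dvd M"
  shows "\<exists>N U V A. N > 0 \<and> (\<forall>c\<in>C. A c * (monom 1 (m c) - 1) = monom 1 M - 1) \<and>
    [:int N:] = U * (\<Prod>c\<in>C. monom 1 (m c) - 1) + (\<Sum>c\<in>C. V c * A c)"
proof -
  have "\<forall>c\<in>C. \<exists>u A :: int poly. A * (monom 1 (m c) - 1) = monom 1 M - 1 \<and>
      of_nat (M div m c) = (monom 1 (m c) - 1) * u + A"
    using monom_minus_1_complement assms(3) by blast
  then obtain u A :: "'i \<Rightarrow> int poly"
    where A: "\<And>c. c \<in> C \<Longrightarrow> A c * (monom 1 (m c) - 1) = monom 1 M - 1"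
      and k: "\<And>c. c \<in> C \<Longrightarrow> of_nat (M div m c) = (monom 1 (m c) - 1) * u c + A c"
    by metis
  obtain U V where "(\<Prod>c\<in>C. of_nat (M div m c)) =
      U * (\<Prod>c\<in>C. monom 1 (m c) - 1) + (\<Sum>c\<in>C. V c * A c)"
    using prod_eq_combination[of C "\<lambda>c. of_nat (M div m c)" "\<lambda>c. monom 1 (m c) - 1" u A] assms(1) k
    by blast
  moreover define K where "K = (\<Prod>c\<in>C. M div m c)"
  have "(\<Prod>c\<in>C. of_nat (M div m c)) = [:int K:]"
    unfolding K_def by (subst of_nat_prod[symmetric]) (rule of_nat_poly)
  moreover have "K > 0"
    unfolding K_def using assms(2,3) by (intro prod_pos) (metis dvd_div_eq_0_iff gr0I)
  ultimately have "K > 0 \<and> (\<forall>c\<in>C. A c * (monom 1 (m c) - 1) = monom 1 M - 1) \<and>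
      [:int K:] = U * (\<Prod>c\<in>C. monom 1 (m c) - 1) + (\<Sum>c\<in>C. V c * A c)"
    using A by simp
  then show ?thesis by (intro exI)
qed

text \<open>Both the full product and \<open>monom 1 M - 1\<close> kill \<open>f\<close>, so the
  combination leaves \<open>N f\<close> as a sum of terms \<open>V c * A c\<close> applied to
  \<open>f\<close>. Each is \<open>c\<close>-periodic since \<open>A c\<close> is the cofactor of
  its difference polynomial; saturation then removes \<open>N\<close>.\<close>

lemma act_eq_0_imp_decomposable:
  fixes f :: "'a::ab_group_add \<Rightarrow> 'b::ab_group_add" and \<kappa> :: "'a \<Rightarrow> int"
  assumes "torsion_free TYPE('b)" and e: "\<And>k. imul k e = 0 \<Longrightarrow> k = 0"
    and M: "M > 0" and C: "finite C" "\<And>c. c \<in> C \<Longrightarrow> c = imul (\<kappa> c) e \<and> \<kappa> c dvd int M"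
    and P: "P dvd (\<Prod>c\<in>C. monom 1 (nat \<bar>\<kappa> c\<bar>) - 1)" "P dvd monom 1 M - 1"
    and "act e P f = (\<lambda>x. 0)"
  shows "decomposable C f"
proof -
  have kill: "act e S f = (\<lambda>x. 0)" if "P dvd S" for S
    using that assms(8) by (metis act_fun_0 act_mult dvdE mult.commute)
  have "nat \<bar>\<kappa> c\<bar> dvd M" if "c \<in> C" for c
    using conjunct2[OF C(2)[OF that]] by (simp add: nat_abs_dvd_iff)
  from monom_minus_1_combination[where m = "\<lambda>c. nat \<bar>\<kappa> c\<bar>", OF C(1) M this] obtain N U V A where N: "N > 0"
    and A: "\<And>c. c \<in> C \<Longrightarrow> A c * (monom 1 (nat \<bar>\<kappa> c\<bar>) - 1) = monom 1 M - 1"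
    and eq: "[:int N:] = U * (\<Prod>c\<in>C. monom 1 (nat \<bar>\<kappa> c\<bar>) - 1) + (\<Sum>c\<in>C. V c * A c)"
    by blast
  have "(\<lambda>x. imul (int N) (f x)) = act e [:int N:] f"
    by simp
  also have "\<dots> = (\<lambda>x. \<Sum>c\<in>C. act e (V c * A c) f x)"
    using kill[OF dvd_mult[OF P(1), of U]] unfolding eq act_add act_sum by simp
  finally have "(\<lambda>x. imul (int N) (f x)) = (\<lambda>x. \<Sum>c\<in>C. act e (V c * A c) f x)" .
  moreover have "periodic c (act e (V c * A c) f)" if "c \<in> C" for c
  proof -
    have eq': "(monom 1 (nat \<bar>\<kappa> c\<bar>) - 1) * (V c * A c) = V c * (monom 1 M - 1)"
      unfolding A[OF that, symmetric] by (simp only: ac_simps)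
    have "diff_op (imul (int (nat \<bar>\<kappa> c\<bar>)) e) (act e (V c * A c) f) = (\<lambda>x. 0)"
      using kill[OF dvd_mult[OF P(2), of "V c"]]
      by (simp only: act_monom_minus_1[symmetric] act_mult[symmetric] eq')
    then have "periodic (imul \<bar>\<kappa> c\<bar> e) (act e (V c * A c) f)"
      by (simp add: periodic_def)
    then show ?thesis
      unfolding periodic_imul_abs using C(2)[OF that] by metis
  qed
  ultimately have dec: "decomposable C (\<lambda>x. imul (int N) (f x))"
    using decomposableI[of C "\<lambda>c. act e (V c * A c) f"] by simp
  have "periodic (imul (int M) e) f"
    using kill[OF P(2)] by (simp add: periodic_def flip: act_monom_minus_1)
  from decomposable_saturated_cyclic[OF assms(1) e M C _ this dec] N
  show ?thesis by simp
qed

subsection \<open>Splitting off one commensurability class\<close>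

text \<open>\<open>indep\<close> makes the difference by \<open>imul (int M) e\<close> surjective on
  \<open>c\<close>-periodic functions for \<open>c\<close> in \<open>R\<close>; \<open>sat\<close>
  cancels integer factors; \<open>D\<close> and \<open>L\<close> are what the two kinds of
  partitions supply.\<close>

lemma decomposable_step:
  fixes f :: "'a::ab_group_add \<Rightarrow> 'b::ab_group_add" and \<kappa> :: "'a \<Rightarrow> int"
  assumes "torsion_free TYPE('b)" and e: "\<And>k. imul k e = 0 \<Longrightarrow> k = 0"
    and M: "M > 0" and C: "finite C" "\<And>c. c \<in> C \<Longrightarrow> c = imul (\<kappa> c) e \<and> \<kappa> c dvd int M"
    and R: "finite R" "C \<inter> R = {}"
    and indep: "\<And>c i j. c \<in> R \<Longrightarrow> imul i c = imul j (imul (int M) e) \<Longrightarrow> j = 0"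
    and sat: "\<And>N (h :: 'a \<Rightarrow> 'b). N \<noteq> 0 \<Longrightarrow> decomposable R (\<lambda>x. imul N (h x)) \<Longrightarrow> decomposable R h"
    and D: "decomposable R (act e (\<Prod>c\<in>C. monom 1 (nat \<bar>\<kappa> c\<bar>) - 1) f)"
    and L: "decomposable R (diff_op (imul (int M) e) f)"
  shows "decomposable (C \<union> R) f"
proof -
  define q :: "'a \<Rightarrow> int poly" where "q c = monom 1 (nat \<bar>\<kappa> c\<bar>) - 1" for c
  \<comment> \<open>The product of the \<open>q c\<close> need not divide
    \<open>monom 1 M - 1\<close>, as X - 1 divides every factor. The least common multiple does,
    which makes \<open>P\<close> invertible from the right on the periodic functions below.\<close>
  define P where "P = Lcm (q ` C)"
  have qP: "q c dvd P" if "c \<in> C" for c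
    unfolding P_def using that by (intro dvd_Lcm imageI)
  have PD: "P dvd (\<Prod>c\<in>C. q c)"
    unfolding P_def using C(1) by (intro Lcm_least) auto
  have dvd: "nat \<bar>\<kappa> c\<bar> dvd M" if "c \<in> C" for c
    using conjunct2[OF C(2)[OF that]] by (simp add: nat_abs_dvd_iff)
  then have "q c dvd monom 1 M - 1" if "c \<in> C" for c
    using monom_minus_1_complement[OF dvd[OF that]] unfolding q_def by (metis dvd_triv_right)
  then have PM: "P dvd monom 1 M - 1"
    unfolding P_def by (intro Lcm_least) auto
  from monom_minus_1_combination[where m = "\<lambda>c. nat \<bar>\<kappa> c\<bar>", OF C(1) M dvd] obtain N U V A where N: "N > 0"
    and A: "\<And>c. c \<in> C \<Longrightarrow> A c * q c = monom 1 M - 1"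
    and eq: "[:int N:] = U * (\<Prod>c\<in>C. q c) + (\<Sum>c\<in>C. V c * A c)"
    unfolding q_def by blast
  obtain S where S: "\<And>c. c \<in> C \<Longrightarrow> P = q c * S c"
    using qP unfolding dvd_def by metis
  \<comment> \<open>Multiplication by \<open>P = q c * S c\<close> turns each cofactor
    \<open>A c\<close> into a multiple of \<open>monom 1 M - 1\<close>, so \<open>N P\<close> lies
    in the ideal for which \<open>D\<close> and \<open>L\<close> give decompositions.\<close>
  have VP: "(\<Sum>c\<in>C. V c * A c) * P = (\<Sum>c\<in>C. V c * S c) * (monom 1 M - 1)"
    unfolding sum_distrib_right
  proof (rule sum.cong)
    fix c assume "c \<in> C"
    then show "V c * A c * P = V c * S c * (monom 1 M - 1)"
      by (subst S, assumption) (simp add: ac_simps flip: A)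
  qed simp
  have NP: "[:int N:] * P = U * P * (\<Prod>c\<in>C. q c) + (\<Sum>c\<in>C. V c * S c) * (monom 1 M - 1)"
    unfolding eq distrib_right VP by (simp only: ac_simps)
  have "decomposable R (act e ([:int N:] * P) f)"
    unfolding NP act_add act_mult[of e "U * P"] act_mult[of e "\<Sum>c\<in>C. V c * S c"] act_monom_minus_1
    by (rule decomposable_add[OF decomposable_act[OF D[folded q_def]] decomposable_act[OF L]])
  then have "decomposable R (act e P f)"
    using sat[of "int N"] N by (simp add: act_mult act_smult)
  then obtain g where g: "\<forall>c\<in>R. periodic c (g c)" "act e P f = (\<lambda>x. \<Sum>c\<in>R. g c x)"
    by (rule decomposableE)
  obtain Q where Q: "monom 1 M - 1 = P * Q"
    using PM by blast
  \<comment> \<open>Solve for the full difference \<open>P * Q\<close> first; applying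
    \<open>Q\<close> to that solution solves for \<open>P\<close>.\<close>
  have "\<exists>h. periodic c h \<and> act e P h = g c" if c: "c \<in> R" for c
  proof -
    obtain h where "periodic c h" "diff_op (imul (int M) e) h = g c"
      using diff_op_surj_periodic[of c "imul (int M) e" "g c"] indep[OF c] g(1) c by blast
    then have "periodic c (act e Q h)" "act e P (act e Q h) = g c"
      by (simp_all add: periodic_act Q flip: act_mult act_monom_minus_1)
    then show ?thesis by blast
  qed
  then obtain h where h: "\<And>c. c \<in> R \<Longrightarrow> periodic c (h c)" "\<And>c. c \<in> R \<Longrightarrow> act e P (h c) = g c"
    by metis
  define r where "r x = (\<Sum>c\<in>R. h c x)" for x
  have "act e P r = act e P f"
    unfolding r_def act_fun_sum g(2) using h(2) by simp
  then have "act e P (\<lambda>x. f x - r x) = (\<lambda>x. 0)"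
    by (simp add: act_fun_diff)
  from act_eq_0_imp_decomposable[OF assms(1) e M C PD[unfolded q_def] PM this]
  have "decomposable C (\<lambda>x. f x - r x)" by simp
  moreover have "decomposable R r"
    unfolding r_def using h(1) by (rule decomposableI)
  ultimately have "decomposable (C \<union> R) (\<lambda>x. (f x - r x) + r x)"
    using C(1) R by (rule decomposable_Un)
  then show ?thesis by simp
qed

text \<open>Finitely many elements commensurable with \<open>a\<close> lie in one cyclic subgroup,
  by torsion freeness and Bezout, adding one element at a time.\<close>

lemma ex_common_generator:
  fixes a :: "'a::ab_group_add"
  assumes "torsion_free TYPE('a)" "finite C"
    and "\<And>c. c \<in> C \<Longrightarrow> \<exists>i j. i \<noteq> 0 \<and> imul i c = imul j a"
  shows "\<exists>e. \<forall>c\<in>insert a C. \<exists>k. c = imul k e"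
  using assms(2,3)
proof (induction C rule: finite_induct)
  case empty
  then show ?case by (metis imul_1 insertE empty_iff)
next
  case (insert d C)
  then obtain e where e: "\<And>c. c \<in> insert a C \<Longrightarrow> \<exists>k. c = imul k e"
    by auto
  obtain i j where i: "i \<noteq> 0" "imul i d = imul j a"
    using insert.prems by blast
  obtain l where "a = imul l e" using e by blast
  with i have ij: "imul i d = imul (j * l) e" by (simp add: imul_imul)
  \<comment> \<open>Torsion freeness allows cancelling the gcd, which leaves a relation between
    \<open>d\<close> and \<open>e\<close> with coprime coefficients.\<close>
  obtain i' j' where cop: "i = i' * gcd i (j * l)" "j * l = j' * gcd i (j * l)" "coprime i' j'"
    using gcd_coprime_exists[of i "j * l"] i(1) by auto
  have "imul (gcd i (j * l)) (imul i' d - imul j' e) = imul i d - imul (j * l) e"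
    unfolding imul_diff_right imul_imul using cop(1,2) by (metis mult.commute)
  then have de: "imul i' d = imul j' e"
    using torsion_free_imul[OF assms(1)] ij i(1) by (metis eq_iff_diff_eq_0 gcd_eq_0_iff)
  obtain u v where uv: "u * i' + v * j' = 1"
    using cop(3) bezout_int[of i' j'] by (auto simp: coprime_iff_gcd_eq_1)
  \<comment> \<open>The Bezout coefficients are attached crosswise, so that
    \<open>e = imul i' e'\<close> and \<open>d = imul j' e'\<close>.\<close>
  define e' where "e' = imul u e + imul v d"
  have "imul i' e' = imul (u * i') e + imul v (imul i' d)"
    by (simp add: e'_def imul_add_right imul_imul mult.commute)
  also have "\<dots> = imul (u * i' + v * j') e"
    by (simp add: de imul_imul imul_add_left)
  finally have e_eq: "e = imul i' e'" by (simp add: uv)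
  have "imul j' e' = imul u (imul j' e) + imul (v * j') d"
    by (simp add: e'_def imul_add_right imul_imul mult.commute)
  also have "\<dots> = imul (u * i' + v * j') d"
    by (simp add: imul_imul imul_add_left flip: de)
  finally have d_eq: "d = imul j' e'" by (simp add: uv)
  have "\<exists>k. c = imul k e'" if "c \<in> insert a C" for c
    using e[OF that] e_eq imul_imul by metis
  then show ?case using d_eq by blast
qed

text \<open>Since \<open>e\<close> has infinite order, membership in cyclic subgroups of its
  multiples is divisibility of integers.\<close>

lemma is_lcm_Lcm:
  fixes \<kappa> :: "'a::ab_group_add \<Rightarrow> int"
  assumes e: "\<And>k. imul k e = 0 \<Longrightarrow> k = 0" and "C \<noteq> {}" "\<And>c. c \<in> C \<Longrightarrow> c = imul (\<kappa> c) e"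
  shows "is_lcm (imul (Lcm (\<kappa> ` C)) e) C"
proof -
  have inj: "i = j" if "imul i e = imul j e" for i j
    using e[of "i - j"] that by (simp add: imul_diff_left)
  have mem: "imul i e \<in> group_closure {imul j e} \<longleftrightarrow> j dvd i" for i j
    unfolding group_closure_eq_range_imul imul_imul
    by (auto simp: dvd_def mult.commute dest: inj)
  have cl: "group_closure {imul j e} \<subseteq> range (\<lambda>k. imul k e)" for j
    unfolding group_closure_eq_range_imul imul_imul by auto
  have "group_closure {imul (Lcm (\<kappa> ` C)) e} = (\<Inter>c\<in>C. group_closure {imul (\<kappa> c) e})"
  proof (intro equalityI subsetI)
    fix x assume x: "x \<in> group_closure {imul (Lcm (\<kappa> ` C)) e}"
    then obtain i where "x = imul i e" using cl by blast
    with x show "x \<in> (\<Inter>c\<in>C. group_closure {imul (\<kappa> c) e})"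
      by (auto simp: mem Lcm_dvd_iff)
  next
    fix x assume x: "x \<in> (\<Inter>c\<in>C. group_closure {imul (\<kappa> c) e})"
    moreover obtain c where "c \<in> C" using assms(2) by blast
    ultimately obtain i where "x = imul i e" using cl by blast
    with x show "x \<in> group_closure {imul (Lcm (\<kappa> ` C)) e}"
      by (auto simp: mem Lcm_dvd_iff)
  qed
  also have "\<dots> = (\<Inter>c\<in>C. group_closure {c})"
    by (intro INF_cong refl) (simp flip: assms(3))
  finally show ?thesis by (simp add: is_lcm_def)
qed

text \<open>Partitions of \<open>R\<close> are completed by the fixed blocks \<open>Cs\<close>, and
  \<open>foldr\<close> over \<open>bs @ cs\<close> applies the \<open>cs\<close> first.\<close>

lemma partition_cond_split:
  assumes "partition_cond (R \<union> C) f" "R \<inter> C = {}"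
    and Cs: "distinct Cs" "partition_on C (set Cs)" "list_all2 is_lcm cs Cs"
  shows "partition_cond R (foldr diff_op cs f)"
  unfolding partition_cond_def
proof (intro allI impI)
  fix Bs bs
  assume Bs: "distinct Bs" "partition_on R (set Bs)" "list_all2 is_lcm bs Bs"
  have "set Bs \<inter> set Cs = {}"
  proof (rule equals0I)
    fix B assume "B \<in> set Bs \<inter> set Cs"
    then have "B \<subseteq> R" "B \<subseteq> C" "B \<noteq> {}"
      using Bs(2) Cs(2) by (auto simp: partition_on_def)
    then show False using assms(2) by blast
  qed
  then have "distinct (Bs @ Cs)" using Bs Cs by simp
  moreover have "partition_on (R \<union> C) (set (Bs @ Cs))"
  proof (rule partition_onI)
    show "\<Union>(set (Bs @ Cs)) = R \<union> C"
      using Bs(2) Cs(2) by (simp add: partition_on_def)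
    fix p q assume "p \<in> set (Bs @ Cs)" "q \<in> set (Bs @ Cs)" "p \<noteq> q"
    moreover have "B \<subseteq> R" if "B \<in> set Bs" for B
      using that Bs(2) by (auto simp: partition_on_def)
    moreover have "B \<subseteq> C" if "B \<in> set Cs" for B
      using that Cs(2) by (auto simp: partition_on_def)
    moreover have "disjnt p q" if "p \<in> set Bs" "q \<in> set Bs"
      using that Bs(2) \<open>p \<noteq> q\<close> by (auto simp: partition_on_def disjoint_def disjnt_def)
    moreover have "disjnt p q" if "p \<in> set Cs" "q \<in> set Cs"
      using that Cs(2) \<open>p \<noteq> q\<close> by (auto simp: partition_on_def disjoint_def disjnt_def)
    ultimately show "disjnt p q"
      using assms(2) unfolding disjnt_def set_append by blast
  next
    show "{} \<notin> set (Bs @ Cs)"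
      using Bs(2) Cs(2) by (auto simp: partition_on_def)
  qed
  moreover have "list_all2 is_lcm (bs @ cs) (Bs @ Cs)"
    using Bs(3) Cs(3) by (rule list_all2_appendI)
  ultimately have "foldr diff_op (bs @ cs) f = (\<lambda>x. 0)"
    using assms(1) unfolding partition_cond_def by blast
  then show "foldr diff_op bs (foldr diff_op cs f) = (\<lambda>x. 0)" by simp
qed

section \<open>Sufficiency by induction on the set of periods\<close>

lemma partition_cond_imp_decomposable:
  fixes f :: "'a::ab_group_add \<Rightarrow> 'b::ab_group_add"
  assumes tf: "torsion_free TYPE('a)" "torsion_free TYPE('b)"
    and "finite F" "partition_cond F f"
  shows "decomposable F f"
  using assms(3,4)
proof (induction F arbitrary: f rule: finite_psubset_induct)
  case (psubset F)
  consider "0 \<in> F" | "F = {}" | a where "a \<in> F" "0 \<notin> F" by blast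
  then show ?case
  proof cases
    case 1
    then show ?thesis using decomposable_zero_mem psubset.hyps by blast
  next
    case 2
    \<comment> \<open>The empty partition forces \<open>f\<close> to be the empty sum.\<close>
    then have "foldr diff_op [] f = (\<lambda>x. 0)"
      using psubset.prems unfolding partition_cond_def
      by (metis distinct.simps(1) list.rel_intros(1) list.set(1) partition_on_empty)
    then show ?thesis using 2 by (simp add: decomposable_def)
  next
    case 3
    define C where "C = {c \<in> F. \<exists>i j. i \<noteq> 0 \<and> imul i c = imul j a}"
    define R where "R = F - C"
    have "imul 1 a = imul 1 a \<and> (1::int) \<noteq> 0" by simp
    then have a: "a \<in> C" unfolding C_def using \<open>a \<in> F\<close> by blast
    have CR: "C \<union> R = F" "R \<union> C = F" "C \<inter> R = {}" "R \<inter> C = {}" "finite C" "finite R" "R \<subset> F"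
      using psubset.hyps a by (auto simp: R_def C_def)
    obtain e where "\<forall>c\<in>insert a C. \<exists>k. c = imul k e"
      using ex_common_generator[OF tf(1) CR(5), of a] by (auto simp: C_def)
    then obtain \<kappa> where \<kappa>: "\<And>c. c \<in> C \<Longrightarrow> c = imul (\<kappa> c) e"
      by (metis insertCI)
    have nz: "c \<noteq> 0" if "c \<in> C" for c
      using that \<open>0 \<notin> F\<close> by (auto simp: C_def)
    have \<kappa>0: "\<kappa> c \<noteq> 0" if "c \<in> C" for c
      using nz[OF that] \<kappa>[OF that] by (metis imul_0)
    have e: "k = 0" if "imul k e = 0" for k
      using torsion_free_imul[OF tf(1) that] nz[OF a] \<kappa>[OF a] by (metis imul_0_right)
    define M where "M = nat (Lcm (\<kappa> ` C))"
    have M: "int M = Lcm (\<kappa> ` C)" by (simp add: M_def)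
    have "Lcm (\<kappa> ` C) \<noteq> 0"
      using CR(5) \<kappa>0 by (subst Lcm_0_iff) auto
    then have "M > 0" using M by (metis gr0I of_nat_0)
    have C: "c = imul (\<kappa> c) e \<and> \<kappa> c dvd int M" if "c \<in> C" for c
      using \<kappa> that by (simp add: M)
    have IH: "decomposable R h" if "partition_cond R h" for h :: "'a \<Rightarrow> 'b"
      using psubset.IH[OF CR(7) that] .
    have cond: "partition_cond (R \<union> C) f" using psubset.prems CR by simp
    \<comment> \<open>Necessity gives the partition condition for \<open>N h\<close>; torsion
      freeness passes it to \<open>h\<close>, where the induction hypothesis applies.\<close>
    have sat: "decomposable R h" if "N \<noteq> 0" "decomposable R (\<lambda>x. imul N (h x))"
      for N and h :: "'a \<Rightarrow> 'b"
    proof (rule IH)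
      have "(\<lambda>x. imul N (foldr diff_op bs h x)) = (\<lambda>x. 0) \<Longrightarrow> foldr diff_op bs h = (\<lambda>x. 0)" for bs
        using torsion_free_imul[OF tf(2) _ that(1)] by (metis (no_types, lifting))
      then show "partition_cond R h"
        using decomposable_imp_partition_cond[OF that(2)]
        unfolding partition_cond_def foldr_diff_op_imul by blast
    qed
    \<comment> \<open>Multiplying by \<open>\<kappa> a\<close> rewrites the right side as a multiple
      of \<open>a\<close>; as \<open>c\<close> is not commensurable with \<open>a\<close>, this
      forces \<open>i = 0\<close>.\<close>
    have indep: "j = 0" if "c \<in> R" "imul i c = imul j (imul (int M) e)" for c i j
    proof -
      have "imul (\<kappa> a * i) c = imul (j * int M) (imul (\<kappa> a) e)"
        using that(2) by (metis imul_imul mult.commute)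
      then have "imul (\<kappa> a * i) c = imul (j * int M) a"
        by (simp only: \<kappa>[OF a, symmetric])
      then have "\<kappa> a * i = 0"
        using that(1) unfolding R_def C_def by blast
      then have "imul (j * int M) e = 0"
        using that(2) \<kappa>0[OF a] by (simp add: imul_imul)
      from e[OF this] show ?thesis using \<open>M > 0\<close> by simp
    qed
    have "partition_on C {C}"
      using a by (auto intro!: partition_onI)
    then have "partition_cond R (foldr diff_op [imul (int M) e] f)"
      using is_lcm_Lcm[OF e _ \<kappa>] a
      by (intro partition_cond_split[OF cond CR(4), of "[C]"]) (auto simp: M)
    then have L: "decomposable R (diff_op (imul (int M) e) f)"
      using IH by simp
    obtain l where l: "set l = C" "distinct l"
      using finite_distinct_list[OF CR(5)] by blast
    \<comment> \<open>Exponents of monomials are natural numbers, so \<open>c\<close> may have to be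
      replaced by \<open>- c\<close>, an equally valid least common multiple of
      \<open>{c}\<close>.\<close>
    have lcm: "is_lcm (imul \<bar>\<kappa> c\<bar> e) {c}" if "c \<in> C" for c
      using is_lcm_single[of c] is_lcm_uminus_single[of c] \<kappa>[OF that]
      by (metis abs_if imul_minus_left)
    have "partition_cond R (foldr diff_op (map (\<lambda>c. imul (int (nat \<bar>\<kappa> c\<bar>)) e) l) f)"
    proof (rule partition_cond_split[OF cond CR(4)])
      show "distinct (map (\<lambda>c. {c}) l)"
        using l(2) by (simp add: distinct_map)
      show "partition_on C (set (map (\<lambda>c. {c}) l))"
        using l(1) by (auto intro!: partition_onI)
      show "list_all2 is_lcm (map (\<lambda>c. imul (int (nat \<bar>\<kappa> c\<bar>)) e) l) (map (\<lambda>c. {c}) l)"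
        using l(1) lcm by (auto simp: list_all2_conv_all_nth)
    qed
    then have "decomposable R (act e (\<Prod>c\<in>C. monom 1 (nat \<bar>\<kappa> c\<bar>) - 1) f)"
      unfolding foldr_diff_op_eq_act prod.distinct_set_conv_list[OF l(2), symmetric] l(1) by (rule IH)
    from decomposable_step[OF tf(2) e \<open>M > 0\<close> CR(5) C CR(6,3) indep sat this L]
    show ?thesis by (simp add: CR)
  qed
qed

theorem theorem4p1:
  fixes f :: "'a::ab_group_add \<Rightarrow> 'b::ab_group_add"
    and a :: "nat \<Rightarrow> 'a"
    and n :: nat
  assumes "torsion_free TYPE('a)" and "torsion_free TYPE('b)"
  shows "(\<exists>g :: nat \<Rightarrow> 'a \<Rightarrow> 'b.
            (\<forall>j\<in>{1..n}. periodic (a j) (g j)) \<and> f = (\<lambda>x. \<Sum>j=1..n. g j x))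
    \<longleftrightarrow> (\<forall>Bs bs. distinct Bs \<longrightarrow> partition_on (a ` {1..n}) (set Bs) \<longrightarrow> list_all2 is_lcm bs Bs
            \<longrightarrow> foldr diff_op bs f = (\<lambda>x. 0))"
  using decomposable_image_iff[of "{1..n}" a f]
    decomposable_imp_partition_cond[of "a ` {1..n}" f]
    partition_cond_imp_decomposable[OF assms, of "a ` {1..n}" f]
  unfolding partition_cond_def by blast

end
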